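(* Let $Y \in L^2(\Omega;\mathbb{R})$ and let $(Y_\ell)_{\ell \in \mathbb{N}_0}$ be a sequence of square integrable real-valued approximations of $Y$ such that $\lim_{\ell\to\infty} |\mathbb{E}[Y-Y_\ell]| = 0$. Choosing for a fixed level $L \in \mathbb{N}$ the sample sizes in the multilevel Monte Carlo estimator $E^L[Y_L]$ as \[ N_0 = \lceil |\mathbb{E}[Y-Y_L]|^{-2} \rceil \quad\text{and}\quad N_\ell = \lceil |\mathbb{E}[Y-Y_L]|^{-2}\, \mathrm{Var}[Y_\ell - Y_{\ell-1}]\, \ell^{1+\epsilon} \rceil \quad \text{for } \ell = 1,\ldots,L \] and some $\epsilon > 0$, it holds that \[ \big\| |\mathbb{E}[Y - Y_L]| - |\mathbb{E}[Y] - E^L[Y_L]| \big\|_{L^2(\Omega;\mathbb{R})} \ge \left( 2^{-1/2}(3 + \mathrm{Var}[Y_0])^{1/2} - 1\right) |\mathbb{E}[Y-Y_L]| \] and \[ \big\| |\mathbb{E}[Y - Y_L]| - |\mathbb{E}[Y] - E^L[Y_L]| \big\|_{L^2(\Omega;\mathbb{R})} \le (\mathrm{Var}[Y_0] + \zeta(1+\epsilon))^{1/2}\, |\mathbb{E}[Y-Y_L]|. \] Therefore, \[ \big\| |\mathbb{E}[Y - Y_L]| - |\mathbb{E}[Y] - E^L[Y_L]| \big\|_{L^2(\Omega;\mathbb{R})} \simeq |\mathbb{E}[Y-Y_L]|, \] i.e., the sampling error (the left-hand side) converges with the same rate as $|\mathbb{E}[Y-Y_L]|$.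
   Context: $(\Omega,\mathcal{A},P)$ is a probability space, and $L^2(\Omega;\mathbb{R})$ is the space of real-valued random variables $Z$ with $\|Z\|_{L^2(\Omega;\mathbb{R})}^2 = \mathbb{E}[|Z|^2] < \infty$. $\mathbb{E}$ denotes expectation and $\mathrm{Var}$ variance. For a real-valued random variable $Z$ and $N \in \mathbb{N}$, the Monte Carlo estimator is $E_N[Z] = N^{-1}\sum_{i=1}^N Z^{(i)}$, where $(Z^{(i)})_{i=1}^N$ is a sequence of independent, identically distributed random variables with the same law as $Z$. For a sequence of random variables $(Y_\ell)_{\ell\in\mathbb{N}_0}$, $L \in \mathbb{N}$ and level-specific numbers of samples $(N_\ell)_{\ell=0}^L$, the multilevel Monte Carlo estimator is \[ E^L[Y_L] = E_{N_0}[Y_0] + \sum_{\ell=1}^L E_{N_\ell}[Y_\ell - Y_{\ell-1}], \] where the Monte Carlo estimators on different levels are independent of each other. $\lceil x \rceil$ is the smallest integer greater than or equal to $x$, $\zeta$ denotes the Riemann zeta function, and $\simeq$ means being of the same size up to multiplicative constants.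
   Formalization: The first lower bound is false for arbitrary fixed L; it is proved when |E[Y-Y_L]|^{-2} and |E[Y-Y_L]|^{-2} Var[Y_1-Y_0] are both at least 1/2, and for all sufficiently large L without this. Nonzero E[Y-Y_L] and all N_l ≥ 1 are assumed so that the estimator is defined. *)

theory Defs
  imports "HOL-Probability.Probability"
begin

definition square_integrable :: "'a measure \<Rightarrow> ('a \<Rightarrow> real) \<Rightarrow> bool" where
  "square_integrable M Z \<longleftrightarrow>
     Z \<in> borel_measurable M \<and> integrable M (\<lambda>\<omega>. \<bar>Z \<omega>\<bar>\<^sup>2)"

text \<open>Meaningful for square integrable \<open>Z\<close> only: the Bochner integral of a
  non-integrable function is 0.\<close>

definition L2_norm :: "'a measure \<Rightarrow> ('a \<Rightarrow> real) \<Rightarrow> real" where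
  "L2_norm M Z = sqrt (prob_space.expectation M (\<lambda>\<omega>. \<bar>Z \<omega>\<bar>\<^sup>2))"

text \<open>The Riemann zeta function on the real half-line \<open>s > 1\<close>, where the series converges.\<close>

definition real_zeta :: "real \<Rightarrow> real" where
  "real_zeta s = (\<Sum>n. 1 / real (Suc n) powr s)"

definition iid_copies ::
  "'a measure \<Rightarrow> ('a \<Rightarrow> real) \<Rightarrow> nat \<Rightarrow> (nat \<Rightarrow> 'a \<Rightarrow> real) \<Rightarrow> bool" where
  "iid_copies M Z N X \<longleftrightarrow>
     prob_space.indep_vars M (\<lambda>_. borel) X {1..N} \<and>
     (\<forall>i\<in>{1..N}. distr M borel (X i) = distr M borel Z)"

definition mc_estimator :: "nat \<Rightarrow> (nat \<Rightarrow> 'a \<Rightarrow> real) \<Rightarrow> 'a \<Rightarrow> real" where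
  "mc_estimator N X \<omega> = (1 / real N) * (\<Sum>i=1..N. X i \<omega>)"

text \<open>\<open>X l i\<close> is the \<open>i\<close>-th sample on level \<open>l\<close>: a copy of \<open>Ys 0\<close> on level 0 and of the
  increment \<open>Ys l - Ys (l - 1)\<close> (sampled as one random variable) on the levels \<open>l \<ge> 1\<close>.
  A Monte Carlo estimator needs at least one sample, so all \<open>N l\<close> are positive.\<close>

definition mlmc_samples ::
  "'a measure \<Rightarrow> (nat \<Rightarrow> 'a \<Rightarrow> real) \<Rightarrow> nat \<Rightarrow> (nat \<Rightarrow> nat) \<Rightarrow> (nat \<Rightarrow> nat \<Rightarrow> 'a \<Rightarrow> real) \<Rightarrow> bool"
where
  "mlmc_samples M Ys L N X \<longleftrightarrow>
     (\<forall>l\<in>{0..L}. N l \<ge> 1) \<and>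
     iid_copies M (Ys 0) (N 0) (X 0) \<and>
     (\<forall>l\<in>{1..L}. iid_copies M (\<lambda>\<omega>. Ys l \<omega> - Ys (l - 1) \<omega>) (N l) (X l)) \<and>
     prob_space.indep_vars M (\<lambda>_. borel) (\<lambda>l. mc_estimator (N l) (X l)) {0..L}"

definition mlmc_estimator ::
  "nat \<Rightarrow> (nat \<Rightarrow> nat) \<Rightarrow> (nat \<Rightarrow> nat \<Rightarrow> 'a \<Rightarrow> real) \<Rightarrow> 'a \<Rightarrow> real" where
  "mlmc_estimator L N X \<omega> =
     mc_estimator (N 0) (X 0) \<omega> + (\<Sum>l=1..L. mc_estimator (N l) (X l) \<omega>)"

definition weak_error :: "'a measure \<Rightarrow> ('a \<Rightarrow> real) \<Rightarrow> (nat \<Rightarrow> 'a \<Rightarrow> real) \<Rightarrow> nat \<Rightarrow> real" where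
  "weak_error M Y Ys L = \<bar>prob_space.expectation M (\<lambda>\<omega>. Y \<omega> - Ys L \<omega>)\<bar>"

text \<open>Meaningful for \<open>weak_error M Y Ys L \<noteq> 0\<close> only. A level \<open>l \<ge> 1\<close> whose increment has
  variance 0 gets sample size 0, which \<open>mlmc_samples\<close> rules out.\<close>

definition sample_size ::
  "'a measure \<Rightarrow> ('a \<Rightarrow> real) \<Rightarrow> (nat \<Rightarrow> 'a \<Rightarrow> real) \<Rightarrow> real \<Rightarrow> nat \<Rightarrow> nat \<Rightarrow> nat" where
  "sample_size M Y Ys \<epsilon> L l =
     (if l = 0 then nat \<lceil>weak_error M Y Ys L powi (-2)\<rceil>
      else nat \<lceil>weak_error M Y Ys L powi (-2)
                 * prob_space.variance M (\<lambda>\<omega>. Ys l \<omega> - Ys (l - 1) \<omega>)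
                 * real l powr (1 + \<epsilon>)\<rceil>)"

definition sampling_error ::
  "'a measure \<Rightarrow> ('a \<Rightarrow> real) \<Rightarrow> (nat \<Rightarrow> 'a \<Rightarrow> real) \<Rightarrow> nat \<Rightarrow> (nat \<Rightarrow> nat) \<Rightarrow>
   (nat \<Rightarrow> nat \<Rightarrow> 'a \<Rightarrow> real) \<Rightarrow> 'a \<Rightarrow> real" where
  "sampling_error M Y Ys L N X \<omega> =
     weak_error M Y Ys L - \<bar>prob_space.expectation M Y - mlmc_estimator L N X \<omega>\<bar>"

text \<open>The multilevel Monte Carlo estimator with samples \<open>X\<close> and the prescribed sample sizes
  for level \<open>L\<close>; these are defined only if the weak error does not vanish.\<close>

definition mlmc_setup ::
  "'a measure \<Rightarrow> ('a \<Rightarrow> real) \<Rightarrow> (nat \<Rightarrow> 'a \<Rightarrow> real) \<Rightarrow> real \<Rightarrow> nat \<Rightarrow>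
   (nat \<Rightarrow> nat \<Rightarrow> 'a \<Rightarrow> real) \<Rightarrow> bool" where
  "mlmc_setup M Y Ys \<epsilon> L X \<longleftrightarrow>
     L \<ge> 1 \<and> weak_error M Y Ys L \<noteq> 0 \<and> mlmc_samples M Ys L (sample_size M Y Ys \<epsilon> L) X"

definition sampling_error_norm ::
  "'a measure \<Rightarrow> ('a \<Rightarrow> real) \<Rightarrow> (nat \<Rightarrow> 'a \<Rightarrow> real) \<Rightarrow> real \<Rightarrow> nat \<Rightarrow>
   (nat \<Rightarrow> nat \<Rightarrow> 'a \<Rightarrow> real) \<Rightarrow> real" where
  "sampling_error_norm M Y Ys \<epsilon> L X =
     L2_norm M (sampling_error M Y Ys L (sample_size M Y Ys \<epsilon> L) X)"

text \<open>The lower bound with the constant \<open>2 powr (-1/2) * sqrt (3 + Var Y\<^sub>0) - 1\<close> rests on rounding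
  up at most doubling the sample sizes on the levels 0 and 1, that is, on the arguments of these
  two ceilings being at least 1/2. Without this it can fail: if \<open>Y\<^sub>0 = 0\<close>, \<open>L = 1\<close>, the weak error
  is 1 and \<open>Var Y\<^sub>1 = 1/100\<close>, then the sampling error has norm at most 1/10, but the bound
  is about 0.22. If the weak error converges to 0, the condition holds for all large \<open>L\<close> as soon
  as \<open>Y\<^sub>1 - Y\<^sub>0\<close> is not almost surely constant.\<close>

definition mild_rounding :: "'a measure \<Rightarrow> ('a \<Rightarrow> real) \<Rightarrow> (nat \<Rightarrow> 'a \<Rightarrow> real) \<Rightarrow> nat \<Rightarrow> bool" where
  "mild_rounding M Y Ys L \<longleftrightarrow>
     1 / 2 \<le> weak_error M Y Ys L powi (-2) \<and>
     1 / 2 \<le> weak_error M Y Ys L powi (-2)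
             * prob_space.variance M (\<lambda>\<omega>. Ys 1 \<omega> - Ys 0 \<omega>)"

end

theory Submission imports Defs begin

text \<open>Write \<open>e\<close> for the weak error, \<open>S\<close> for the multilevel estimator and \<open>V\<close> for its variance.
  By independence \<open>V\<close> is the sum of the variances of the level increments divided by the sample
  sizes, and \<open>S\<close> is an unbiased estimator of \<open>E[Y\<^sub>L]\<close>, so that \<open>e = \<bar>E[Y] - E[S]\<bar>\<close>. The reverse
  triangle inequality bounds the sampling error pointwise by \<open>\<bar>S - E[S]\<bar>\<close>, hence its norm by the
  square root of \<open>V\<close>. Conversely \<open>E[Y] - S\<close> has squared norm \<open>e\<^sup>2 + V\<close>, so by Minkowski's inequality
  the sampling error has norm at least \<open>sqrt (e\<^sup>2 + V) - e\<close>. What remains is to compare \<open>V\<close> with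
  \<open>e\<^sup>2\<close>.\<close>

section \<open>Square integrability: closure properties and transfer along equality in law\<close>

lemma square_integrableI:
  fixes Z :: "'a \<Rightarrow> real"
  assumes "Z \<in> borel_measurable M" "integrable M (\<lambda>\<omega>. (Z \<omega>)\<^sup>2)"
  shows "square_integrable M Z"
  using assms by (simp add: square_integrable_def)

lemma square_integrableD:
  assumes "square_integrable M Z"
  shows "Z \<in> borel_measurable M" "integrable M (\<lambda>\<omega>. (Z \<omega>)\<^sup>2)"
  using assms by (simp_all add: square_integrable_def)

lemma square_integrable_cmult:
  assumes "square_integrable M Z"
  shows "square_integrable M (\<lambda>\<omega>. c * Z \<omega>)"
  using square_integrableD[OF assms] by (intro square_integrableI) (auto simp: power_mult_distrib)

lemma square_integrable_abs:
  assumes "square_integrable M Z"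
  shows "square_integrable M (\<lambda>\<omega>. \<bar>Z \<omega>\<bar>)"
  using square_integrableD[OF assms] by (intro square_integrableI) auto

lemma square_integrable_add:
  assumes "square_integrable M X" "square_integrable M Y"
  shows "square_integrable M (\<lambda>\<omega>. X \<omega> + Y \<omega>)"
proof (rule square_integrableI)
  note X[measurable] = square_integrableD[OF assms(1)]
  note Y[measurable] = square_integrableD[OF assms(2)]
  show "(\<lambda>\<omega>. X \<omega> + Y \<omega>) \<in> borel_measurable M" by simp
  \<comment> \<open>The right side exceeds the left by exactly
    \<open>(X \<omega> - Y \<omega>)\<^sup>2\<close>.\<close>
  have "(X \<omega> + Y \<omega>)\<^sup>2 \<le> 2 * (X \<omega>)\<^sup>2 + 2 * (Y \<omega>)\<^sup>2" for \<omega>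
    using zero_le_power2[of "X \<omega> - Y \<omega>"] by (simp add: power2_eq_square algebra_simps)
  then have "norm ((X \<omega> + Y \<omega>)\<^sup>2) \<le> norm (2 * (X \<omega>)\<^sup>2 + 2 * (Y \<omega>)\<^sup>2)" for \<omega>
    using order_trans[OF _ abs_ge_self] by fastforce
  then have bound: "AE \<omega> in M. norm ((X \<omega> + Y \<omega>)\<^sup>2) \<le> norm (2 * (X \<omega>)\<^sup>2 + 2 * (Y \<omega>)\<^sup>2)"
    by (rule AE_I2)
  show "integrable M (\<lambda>\<omega>. (X \<omega> + Y \<omega>)\<^sup>2)"
  proof (rule Bochner_Integration.integrable_bound[OF _ _ bound])
    show "integrable M (\<lambda>\<omega>. 2 * (X \<omega>)\<^sup>2 + 2 * (Y \<omega>)\<^sup>2)"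
      using X(2) Y(2) by simp
  qed measurable
qed

lemma square_integrable_diff:
  assumes "square_integrable M X" "square_integrable M Y"
  shows "square_integrable M (\<lambda>\<omega>. X \<omega> - Y \<omega>)"
  using square_integrable_add[OF assms(1) square_integrable_cmult[OF assms(2), of "-1"]] by simp

lemma square_integrable_sum:
  assumes "\<And>i. i \<in> I \<Longrightarrow> square_integrable M (X i)"
  shows "square_integrable M (\<lambda>\<omega>. \<Sum>i\<in>I. X i \<omega>)"
  using assms
proof (induction I rule: infinite_finite_induct)
  case (insert i I)
  then show ?case
    using square_integrable_add[of M "X i" "\<lambda>\<omega>. \<Sum>i\<in>I. X i \<omega>"] by simp
qed (auto intro: square_integrableI)

text \<open>Samples are tied to \<open>Z\<close> only through their law, so the second moment has to
  be transported through the common distribution on the reals.\<close>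

lemma square_integrable_distr_eq:
  fixes X Z :: "'a \<Rightarrow> real"
  assumes X[measurable]: "X \<in> borel_measurable M" and Z: "square_integrable M Z"
    and eq: "distr M borel X = distr M borel Z"
  shows "square_integrable M X"
proof (rule square_integrableI)
  note [measurable] = square_integrableD(1)[OF Z]
  have "integrable (distr M borel Z) (\<lambda>x. x\<^sup>2)"
    using square_integrableD(2)[OF Z] by (subst integrable_distr_eq) auto
  then show "integrable M (\<lambda>\<omega>. (X \<omega>)\<^sup>2)"
    unfolding eq[symmetric] by (subst (asm) integrable_distr_eq) auto
qed (fact X)

lemma integral_distr_cong:
  fixes X Z :: "'a \<Rightarrow> real" and f :: "real \<Rightarrow> real"
  assumes "X \<in> borel_measurable M" "Z \<in> borel_measurable M" "f \<in> borel_measurable borel"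
    and "distr M borel X = distr M borel Z"
  shows "(\<integral>\<omega>. f (X \<omega>) \<partial>M) = (\<integral>\<omega>. f (Z \<omega>) \<partial>M)"
  using integral_distr[OF assms(1,3)] integral_distr[OF assms(2,3)] assms(4) by simp

section \<open>The zeta series and rounding up\<close>

lemma real_zeta_summable:
  assumes "s > 1"
  shows "summable (\<lambda>n. 1 / real (Suc n) powr s)"
proof -
  have "summable (\<lambda>n. real n powr (-s))"
    using assms summable_real_powr_iff[of "-s"] by simp
  then show ?thesis
    by (subst (asm) summable_Suc_iff[symmetric]) (simp add: powr_minus_divide)
qed

lemma sum_le_real_zeta:
  assumes "s > 1"
  shows "(\<Sum>l=1..L. 1 / real l powr s) \<le> real_zeta s"
proof -
  have "(\<Sum>l=1..L. 1 / real l powr s) = (\<Sum>n<L. 1 / real (Suc n) powr s)"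
    by (rule sum.reindex_bij_witness[of _ Suc "\<lambda>l. l - 1"]) auto
  also have "\<dots> \<le> real_zeta s"
    unfolding real_zeta_def by (rule sum_le_suminf[OF real_zeta_summable[OF assms]]) auto
  finally show ?thesis .
qed

text \<open>Up to 1 the ceiling is 1, which is at most \<open>2 * x\<close> exactly because
  \<open>x \<ge> 1 / 2\<close>; beyond 1 rounding adds less than \<open>x\<close> itself. This is
  the source of the threshold 1/2 in \<open>mild_rounding\<close>.\<close>

lemma ceiling_le_twice:
  assumes "x \<ge> 1 / 2"
  shows "real (nat \<lceil>x\<rceil>) \<le> 2 * x"
proof (cases "x \<le> 1")
  case True
  then have "\<lceil>x\<rceil> = 1" using assms by (simp add: ceiling_unique)
  then show ?thesis using assms by simp
next
  case False
  then show ?thesis by linarith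
qed

lemma powi_minus_two: "(w::real) powi (-2) = 1 / w\<^sup>2"
  by (simp add: power_int_minus divide_inverse)

section \<open>Positivity and closed forms of the prescribed sample sizes\<close>

lemma mlmc_setup_sample_size_pos:
  assumes "mlmc_setup M Y Ys \<epsilon> L X" "l \<le> L"
  shows "sample_size M Y Ys \<epsilon> L l \<ge> 1"
  using assms by (auto simp: mlmc_setup_def mlmc_samples_def)

lemma mlmc_setup_weak_error_pos:
  assumes "mlmc_setup M Y Ys \<epsilon> L X"
  shows "weak_error M Y Ys L > 0"
  using assms by (simp add: mlmc_setup_def weak_error_def)

context prob_space
begin

lemma sample_size_0:
  "sample_size M Y Ys \<epsilon> L 0 = nat \<lceil>1 / (weak_error M Y Ys L)\<^sup>2\<rceil>"
  by (simp add: sample_size_def powi_minus_two)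

lemma sample_size_pos_level:
  assumes "l \<ge> 1"
  shows "sample_size M Y Ys \<epsilon> L l
    = nat \<lceil>variance (\<lambda>\<omega>. Ys l \<omega> - Ys (l - 1) \<omega>) * real l powr (1 + \<epsilon>)
        / (weak_error M Y Ys L)\<^sup>2\<rceil>"
  using assms by (simp add: sample_size_def powi_minus_two)

text \<open>A vanishing variance would prescribe 0 samples, against the requirement of at least one.
  Later estimates rely on this to cancel the increment variance against the one inside the sample
  size.\<close>

lemma mlmc_setup_increment_variance_pos:
  assumes "mlmc_setup M Y Ys \<epsilon> L X" "l \<in> {1..L}"
  shows "variance (\<lambda>\<omega>. Ys l \<omega> - Ys (l - 1) \<omega>) > 0"
proof (rule ccontr)
  assume "\<not> ?thesis"
  then have "variance (\<lambda>\<omega>. Ys l \<omega> - Ys (l - 1) \<omega>) = 0"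
    using variance_positive[of "\<lambda>\<omega>. Ys l \<omega> - Ys (l - 1) \<omega>"] by linarith
  then have "sample_size M Y Ys \<epsilon> L l = 0"
    using assms(2) sample_size_pos_level[of l Y Ys \<epsilon> L] by simp
  then show False
    using mlmc_setup_sample_size_pos[OF assms(1), of l] assms(2) by simp
qed

section \<open>Variances under scaling and under independent summation\<close>

lemma square_integrable_const: "square_integrable M (\<lambda>_. c)"
  by (intro square_integrableI) auto

lemma square_integrable_integrable:
  assumes "square_integrable M Z"
  shows "integrable M Z"
  using square_integrableD[OF assms] by (rule square_integrable_imp_integrable)

lemma variance_cmult:
  fixes Z :: "'a \<Rightarrow> real"
  shows "variance (\<lambda>\<omega>. c * Z \<omega>) = c\<^sup>2 * variance Z"
proof -
  have "(c * Z \<omega> - expectation (\<lambda>\<omega>. c * Z \<omega>))\<^sup>2 = c\<^sup>2 * (Z \<omega> - expectation Z)\<^sup>2" for \<omega>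
    by (simp add: right_diff_distrib[symmetric] power_mult_distrib)
  then show ?thesis by simp
qed

text \<open>Independence factorizes the mixed moment
  \<open>expectation (\<lambda>\<omega>. X \<omega> * Y \<omega>)\<close>, which then cancels
  against the cross term of the squared mean.\<close>

lemma variance_add_indep:
  fixes X Y :: "'a \<Rightarrow> real"
  assumes indep: "indep_var borel X borel Y"
    and X: "square_integrable M X" and Y: "square_integrable M Y"
  shows "variance (\<lambda>\<omega>. X \<omega> + Y \<omega>) = variance X + variance Y"
proof -
  note intX = square_integrable_integrable[OF X] and intY = square_integrable_integrable[OF Y]
  note sqX = square_integrableD(2)[OF X] and sqY = square_integrableD(2)[OF Y]
  note XY = indep_var_integrable[OF indep intX intY]
  have "expectation (\<lambda>\<omega>. (X \<omega> + Y \<omega>)\<^sup>2)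
      = expectation (\<lambda>\<omega>. (X \<omega>)\<^sup>2 + (Y \<omega>)\<^sup>2 + 2 * (X \<omega> * Y \<omega>))"
    by (simp add: power2_sum mult.assoc)
  also have "\<dots> = expectation (\<lambda>\<omega>. (X \<omega>)\<^sup>2) + expectation (\<lambda>\<omega>. (Y \<omega>)\<^sup>2)
      + 2 * (expectation X * expectation Y)"
    using sqX sqY XY indep_var_lebesgue_integral[OF indep intX intY] by simp
  finally have "expectation (\<lambda>\<omega>. (X \<omega> + Y \<omega>)\<^sup>2) = \<dots>" .
  moreover have "variance (\<lambda>\<omega>. X \<omega> + Y \<omega>)
      = expectation (\<lambda>\<omega>. (X \<omega> + Y \<omega>)\<^sup>2) - (expectation X + expectation Y)\<^sup>2"
    using intX intY square_integrableD(2)[OF square_integrable_add[OF X Y]]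
    by (subst variance_eq) auto
  ultimately show ?thesis
    using intX intY sqX sqY by (simp add: variance_eq power2_sum)
qed

lemma variance_sum_indep:
  fixes X :: "'i \<Rightarrow> 'a \<Rightarrow> real"
  assumes "finite I" "indep_vars (\<lambda>_. borel) X I" "\<And>i. i \<in> I \<Longrightarrow> square_integrable M (X i)"
  shows "variance (\<lambda>\<omega>. \<Sum>i\<in>I. X i \<omega>) = (\<Sum>i\<in>I. variance (X i))"
  using assms
proof (induction I rule: finite_induct)
  case (insert i I)
  have "variance (\<lambda>\<omega>. \<Sum>i\<in>insert i I. X i \<omega>) = variance (\<lambda>\<omega>. X i \<omega> + (\<Sum>i\<in>I. X i \<omega>))"
    using insert.hyps by simp
  also have "\<dots> = variance (X i) + variance (\<lambda>\<omega>. \<Sum>i\<in>I. X i \<omega>)"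
    using insert
    by (intro variance_add_indep indep_vars_sum square_integrable_sum) auto
  also have "variance (\<lambda>\<omega>. \<Sum>i\<in>I. X i \<omega>) = (\<Sum>i\<in>I. variance (X i))"
    using insert by (intro insert.IH) (auto intro: indep_vars_subset)
  finally show ?case using insert.hyps by simp
qed simp

section \<open>Moments of the single-level and multilevel estimators\<close>

lemma iid_copies_moments:
  assumes "iid_copies M Z N X" "square_integrable M Z" "i \<in> {1..N}"
  shows "square_integrable M (X i)" "expectation (X i) = expectation Z" "variance (X i) = variance Z"
proof -
  have X: "X i \<in> borel_measurable M" and eq: "distr M borel (X i) = distr M borel Z"
    using assms unfolding iid_copies_def indep_vars_def by auto
  note Z = square_integrableD(1)[OF assms(2)]
  show "square_integrable M (X i)"
    by (rule square_integrable_distr_eq[OF X assms(2) eq])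
  show E: "expectation (X i) = expectation Z"
    using integral_distr_cong[OF X Z _ eq, of "\<lambda>x. x"] by simp
  \<comment> \<open>The transported function is centred at the constant
    \<open>expectation Z\<close>; equality of the means identifies its integral over
    \<open>X i\<close> as a variance.\<close>
  show "variance (X i) = variance Z"
    using integral_distr_cong[OF X Z _ eq, of "\<lambda>x. (x - expectation Z)\<^sup>2"] E by simp
qed

lemma mc_estimator_moments:
  assumes iid: "iid_copies M Z N X" and Z: "square_integrable M Z" and N: "N \<ge> 1"
  shows "square_integrable M (mc_estimator N X)"
    and "expectation (mc_estimator N X) = expectation Z"
    and "variance (mc_estimator N X) = variance Z / real N"
proof -
  note mom = iid_copies_moments[OF iid Z]
  have eq: "mc_estimator N X = (\<lambda>\<omega>. (1 / real N) * (\<Sum>i=1..N. X i \<omega>))"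
    by (simp add: fun_eq_iff mc_estimator_def)
  have S: "square_integrable M (\<lambda>\<omega>. \<Sum>i=1..N. X i \<omega>)"
    by (intro square_integrable_sum mom)
  show "square_integrable M (mc_estimator N X)"
    unfolding eq by (rule square_integrable_cmult[OF S])
  have "expectation (\<lambda>\<omega>. \<Sum>i=1..N. X i \<omega>) = real N * expectation Z"
    using mom square_integrable_integrable by (subst Bochner_Integration.integral_sum) auto
  then show "expectation (mc_estimator N X) = expectation Z"
    unfolding eq using N by simp
  have "variance (\<lambda>\<omega>. \<Sum>i=1..N. X i \<omega>) = real N * variance Z"
    using iid mom by (subst variance_sum_indep) (auto simp: iid_copies_def)
  then show "variance (mc_estimator N X) = variance Z / real N"
    unfolding eq variance_cmult using N by (simp add: power2_eq_square)
qed

text \<open>The means of the increments telescope, so only the bias of the finest level remains; the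
  variances add up because the estimators on different levels are independent.\<close>

lemma mlmc_estimator_moments:
  assumes samples: "mlmc_samples M Ys L N X" and Ys: "\<And>l. square_integrable M (Ys l)"
  shows "square_integrable M (mlmc_estimator L N X)"
    and "expectation (mlmc_estimator L N X) = expectation (Ys L)"
    and "variance (mlmc_estimator L N X)
      = variance (Ys 0) / real (N 0)
        + (\<Sum>l=1..L. variance (\<lambda>\<omega>. Ys l \<omega> - Ys (l - 1) \<omega>) / real (N l))"
proof -
  let ?m = "\<lambda>l. mc_estimator (N l) (X l)"
  let ?D = "\<lambda>l \<omega>. Ys l \<omega> - Ys (l - 1) \<omega>"
  have N: "N l \<ge> 1" if "l \<le> L" for l
    using samples that by (auto simp: mlmc_samples_def)
  have "iid_copies M (Ys 0) (N 0) (X 0)"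
    using samples by (simp add: mlmc_samples_def)
  note m0 = mc_estimator_moments[OF this Ys N[OF le0]]
  have iid: "iid_copies M (?D l) (N l) (X l)" if "l \<in> {1..L}" for l
    using samples that by (simp add: mlmc_samples_def)
  have ml: "square_integrable M (?m l)" "expectation (?m l) = expectation (?D l)"
    "variance (?m l) = variance (?D l) / real (N l)" if "l \<in> {1..L}" for l
    using mc_estimator_moments[OF iid[OF that] square_integrable_diff[OF Ys Ys] N[of l]] that
    by auto
  have sq: "square_integrable M (?m l)" if "l \<in> {0..L}" for l
    using m0(1) ml(1)[of l] that by (cases "l = 0") auto
  have split: "(\<Sum>l=0..L. f l) = f 0 + (\<Sum>l=1..L. f l)" for f :: "nat \<Rightarrow> real"
    by (simp add: sum.atLeast_Suc_atMost)
  have eq: "mlmc_estimator L N X = (\<lambda>\<omega>. \<Sum>l=0..L. ?m l \<omega>)"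
    by (simp add: fun_eq_iff mlmc_estimator_def split)
  show "square_integrable M (mlmc_estimator L N X)"
    unfolding eq by (intro square_integrable_sum sq)
  have "(\<Sum>l=1..L. expectation (?D l)) = (\<Sum>l=1..L. expectation (Ys l) - expectation (Ys (l - 1)))"
    using square_integrable_integrable[OF Ys] by simp
  also have "\<dots> = expectation (Ys L) - expectation (Ys 0)"
    by (induction L) auto
  finally have "(\<Sum>l=1..L. expectation (?D l)) = expectation (Ys L) - expectation (Ys 0)" .
  moreover have "expectation (mlmc_estimator L N X) = (\<Sum>l=0..L. expectation (?m l))"
    unfolding eq using sq square_integrable_integrable
    by (intro Bochner_Integration.integral_sum) auto
  ultimately show "expectation (mlmc_estimator L N X) = expectation (Ys L)"
    using m0(2) ml(2) by (simp add: split)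
  have "variance (mlmc_estimator L N X) = (\<Sum>l=0..L. variance (?m l))"
    unfolding eq using samples sq by (intro variance_sum_indep) (auto simp: mlmc_samples_def)
  then show "variance (mlmc_estimator L N X)
      = variance (Ys 0) / real (N 0) + (\<Sum>l=1..L. variance (?D l) / real (N l))"
    using m0(3) ml(3) by (simp add: split)
qed

section \<open>The sampling error in terms of the estimator variance\<close>

text \<open>Bias-variance decomposition of the mean squared error.\<close>

lemma expectation_square_shift:
  fixes S :: "'a \<Rightarrow> real"
  assumes "square_integrable M S"
  shows "expectation (\<lambda>\<omega>. (y - S \<omega>)\<^sup>2) = (y - expectation S)\<^sup>2 + variance S"
proof -
  note S = square_integrable_integrable[OF assms] square_integrableD(2)[OF assms]
  have "expectation (\<lambda>\<omega>. (y - S \<omega>)\<^sup>2) = y\<^sup>2 + expectation (\<lambda>\<omega>. (S \<omega>)\<^sup>2) - 2 * y * expectation S"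
    using S by (simp add: power2_diff prob_space)
  then show ?thesis
    unfolding variance_eq[OF S] by (simp add: power2_eq_square algebra_simps)
qed

text \<open>The core estimate, for an arbitrary estimator \<open>S\<close> of a number
  \<open>y\<close>. As \<open>e\<close> is constant, the Minkowski step reduces to expanding the
  square of \<open>T\<close> and bounding the mean of \<open>\<bar>y - S \<omega>\<bar>\<close> in
  the cross term by its L2 norm.\<close>

lemma abs_error_moments:
  fixes S :: "'a \<Rightarrow> real" and y :: real
  assumes S: "square_integrable M S"
  defines "e \<equiv> \<bar>y - expectation S\<bar>"
  defines "T \<equiv> \<lambda>\<omega>. e - \<bar>y - S \<omega>\<bar>"
  shows "square_integrable M T"
    and "L2_norm M T \<le> sqrt (variance S)"
    and "sqrt (e\<^sup>2 + variance S) - e \<le> L2_norm M T"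
proof -
  let ?D = "\<lambda>\<omega>. \<bar>y - S \<omega>\<bar>"
  have D: "square_integrable M ?D"
    by (intro square_integrable_abs square_integrable_diff square_integrable_const S)
  show T: "square_integrable M T"
    unfolding T_def by (intro square_integrable_diff square_integrable_const D)
  have "(T \<omega>)\<^sup>2 \<le> (S \<omega> - expectation S)\<^sup>2" for \<omega>
  proof -
    have "\<bar>T \<omega>\<bar> \<le> \<bar>S \<omega> - expectation S\<bar>" unfolding T_def e_def by linarith
    then show ?thesis by (simp add: abs_le_square_iff)
  qed
  then have "expectation (\<lambda>\<omega>. (T \<omega>)\<^sup>2) \<le> variance S"
    by (intro integral_mono square_integrableD T square_integrable_diff S square_integrable_const)
  then show "L2_norm M T \<le> sqrt (variance S)"
    by (simp add: L2_norm_def)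
  \<comment> \<open>By the bias-variance decomposition, \<open>r\<close> is the L2 norm of
    \<open>y - S\<close>.\<close>
  define r where "r = sqrt (e\<^sup>2 + variance S)"
  have r: "expectation (\<lambda>\<omega>. (?D \<omega>)\<^sup>2) = r\<^sup>2"
    using expectation_square_shift[OF S, of y] by (simp add: r_def e_def)
  have r0: "r \<ge> 0" unfolding r_def by (intro real_sqrt_ge_zero add_nonneg_nonneg) auto
  \<comment> \<open>Nonnegativity of the variance serves as the Cauchy-Schwarz inequality between
    the first and second moments of \<open>?D\<close>.\<close>
  have "0 \<le> variance ?D" by (rule variance_positive)
  then have "(expectation ?D)\<^sup>2 \<le> r\<^sup>2"
    unfolding variance_eq[OF square_integrable_integrable[OF D] square_integrableD(2)[OF D]] r
    by simp
  then have Dr: "expectation ?D \<le> r" using r0 by (rule power2_le_imp_le)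
  have "expectation (\<lambda>\<omega>. (T \<omega>)\<^sup>2) = e\<^sup>2 + r\<^sup>2 - 2 * e * expectation ?D"
    using square_integrable_integrable[OF D] square_integrableD(2)[OF D] r
    by (simp add: T_def power2_diff prob_space)
  moreover have "2 * e * expectation ?D \<le> 2 * e * r"
    using Dr by (intro mult_left_mono) (auto simp: e_def)
  ultimately have "(r - e)\<^sup>2 \<le> expectation (\<lambda>\<omega>. (T \<omega>)\<^sup>2)"
    by (simp add: power2_diff mult.commute)
  then show "sqrt (e\<^sup>2 + variance S) - e \<le> L2_norm M T"
    unfolding r_def[symmetric] L2_norm_def by (simp add: real_le_rsqrt)
qed

lemma sampling_error_norm_bounds:
  assumes mlmc: "mlmc_setup M Y Ys \<epsilon> L X"
    and Y: "square_integrable M Y" and Ys: "\<And>l. square_integrable M (Ys l)"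
  defines "N \<equiv> sample_size M Y Ys \<epsilon> L" and "w \<equiv> weak_error M Y Ys L"
  shows "square_integrable M (sampling_error M Y Ys L N X)"
    and "sampling_error_norm M Y Ys \<epsilon> L X \<le> sqrt (variance (mlmc_estimator L N X))"
    and "sqrt (w\<^sup>2 + variance (mlmc_estimator L N X)) - w \<le> sampling_error_norm M Y Ys \<epsilon> L X"
proof -
  have samples: "mlmc_samples M Ys L N X"
    using mlmc by (simp add: mlmc_setup_def N_def)
  \<comment> \<open>The estimator has the mean of \<open>Ys L\<close>, so the weak error is its bias
    as an estimator of \<open>expectation Y\<close>, the quantity \<open>e\<close> of
    \<open>abs_error_moments\<close>.\<close>
  have w: "w = \<bar>expectation Y - expectation (mlmc_estimator L N X)\<bar>"
    using mlmc_estimator_moments(2)[OF samples, OF Ys]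
      square_integrable_integrable[OF Y] square_integrable_integrable[OF Ys]
    by (simp add: w_def weak_error_def)
  have T: "sampling_error M Y Ys L N X = (\<lambda>\<omega>. w - \<bar>expectation Y - mlmc_estimator L N X \<omega>\<bar>)"
    by (simp add: sampling_error_def w_def fun_eq_iff)
  note bounds = abs_error_moments[OF mlmc_estimator_moments(1)[OF samples, OF Ys], of "expectation Y"]
  show "square_integrable M (sampling_error M Y Ys L N X)"
    unfolding T w by (rule bounds(1))
  show "sampling_error_norm M Y Ys \<epsilon> L X \<le> sqrt (variance (mlmc_estimator L N X))"
    unfolding sampling_error_norm_def N_def[symmetric] T w by (rule bounds(2))
  show "sqrt (w\<^sup>2 + variance (mlmc_estimator L N X)) - w \<le> sampling_error_norm M Y Ys \<epsilon> L X"
    unfolding sampling_error_norm_def N_def[symmetric] T w by (rule bounds(3))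
qed

section \<open>Comparing the estimator variance with the squared weak error\<close>

text \<open>Rounding up only increases the sample sizes. Hence level 0 contributes at most
  \<open>variance (Ys 0) * w\<^sup>2\<close>, while on a level \<open>l \<ge> 1\<close> the
  increment variance cancels and leaves a term of the zeta series times
  \<open>w\<^sup>2\<close>.\<close>

lemma mlmc_variance_le:
  assumes mlmc: "mlmc_setup M Y Ys \<epsilon> L X"
    and Ys: "\<And>l. square_integrable M (Ys l)" and eps: "\<epsilon> > 0"
  shows "variance (mlmc_estimator L (sample_size M Y Ys \<epsilon> L) X)
    \<le> (variance (Ys 0) + real_zeta (1 + \<epsilon>)) * (weak_error M Y Ys L)\<^sup>2"
proof -
  define N where "N = sample_size M Y Ys \<epsilon> L"
  define w where "w = weak_error M Y Ys L"
  let ?v = "\<lambda>l. variance (\<lambda>\<omega>. Ys l \<omega> - Ys (l - 1) \<omega>)"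
  have w: "w > 0" using mlmc_setup_weak_error_pos[OF mlmc] by (simp add: w_def)
  have samples: "mlmc_samples M Ys L N X"
    using mlmc by (simp add: mlmc_setup_def N_def)
  have "1 / w\<^sup>2 \<le> real (N 0)"
    unfolding N_def w_def sample_size_0 by (rule real_nat_ceiling_ge)
  then have "variance (Ys 0) / real (N 0) \<le> variance (Ys 0) / (1 / w\<^sup>2)"
    using w mlmc_setup_sample_size_pos[OF mlmc, of 0]
    by (intro divide_left_mono mult_pos_pos) (auto simp: N_def)
  then have level0: "variance (Ys 0) / real (N 0) \<le> variance (Ys 0) * w\<^sup>2" by simp
  have "?v l / real (N l) \<le> 1 / real l powr (1 + \<epsilon>) * w\<^sup>2" if l: "l \<in> {1..L}" for l
  proof -
    have v: "?v l > 0" by (rule mlmc_setup_increment_variance_pos[OF mlmc l])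
    have pos: "?v l * real l powr (1 + \<epsilon>) / w\<^sup>2 > 0"
      using v w l by (intro divide_pos_pos mult_pos_pos) auto
    have le: "?v l * real l powr (1 + \<epsilon>) / w\<^sup>2 \<le> real (N l)"
      using l unfolding N_def w_def
      by (subst sample_size_pos_level) (auto intro: real_nat_ceiling_ge)
    have "?v l / real (N l) \<le> ?v l / (?v l * real l powr (1 + \<epsilon>) / w\<^sup>2)"
      using v pos le by (intro divide_left_mono mult_pos_pos) linarith+
    also have "\<dots> = 1 / real l powr (1 + \<epsilon>) * w\<^sup>2"
      using v by simp
    finally show ?thesis .
  qed
  then have "(\<Sum>l=1..L. ?v l / real (N l)) \<le> (\<Sum>l=1..L. 1 / real l powr (1 + \<epsilon>) * w\<^sup>2)"
    by (rule sum_mono)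
  also have "\<dots> = (\<Sum>l=1..L. 1 / real l powr (1 + \<epsilon>)) * w\<^sup>2"
    by (simp only: sum_distrib_right)
  also have "\<dots> \<le> real_zeta (1 + \<epsilon>) * w\<^sup>2"
    using eps by (intro mult_right_mono sum_le_real_zeta) auto
  finally show ?thesis
    using level0 mlmc_estimator_moments(3)[OF samples, OF Ys]
    by (simp add: N_def w_def distrib_right)
qed

text \<open>Every level contributes nonnegatively, so those above 1 may be dropped; level 1 is
  present because \<open>L \<ge> 1\<close>.\<close>

lemma mlmc_variance_ge:
  assumes mlmc: "mlmc_setup M Y Ys \<epsilon> L X" and Ys: "\<And>l. square_integrable M (Ys l)"
  defines "N \<equiv> sample_size M Y Ys \<epsilon> L"
  shows "variance (Ys 0) / real (N 0) + variance (\<lambda>\<omega>. Ys 1 \<omega> - Ys 0 \<omega>) / real (N 1)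
    \<le> variance (mlmc_estimator L N X)"
proof -
  let ?v = "\<lambda>l. variance (\<lambda>\<omega>. Ys l \<omega> - Ys (l - 1) \<omega>)"
  have samples: "mlmc_samples M Ys L N X" and L: "L \<ge> 1"
    using mlmc by (auto simp: mlmc_setup_def N_def)
  have "?v 1 / real (N 1) \<le> (\<Sum>l=1..L. ?v l / real (N l))"
    using L by (intro member_le_sum) (auto intro!: divide_nonneg_nonneg)
  then show ?thesis
    using mlmc_estimator_moments(3)[OF samples, OF Ys] by simp
qed

text \<open>If rounding at most doubles the sizes on levels 0 and 1, these levels keep at least half
  of their unrounded contributions \<open>variance (Ys 0) * w\<^sup>2\<close> and
  \<open>w\<^sup>2\<close>.\<close>

lemma mlmc_variance_ge_mild_rounding:
  assumes mlmc: "mlmc_setup M Y Ys \<epsilon> L X" and Ys: "\<And>l. square_integrable M (Ys l)"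
    and mild: "mild_rounding M Y Ys L"
  shows "(variance (Ys 0) + 1) / 2 * (weak_error M Y Ys L)\<^sup>2
    \<le> variance (mlmc_estimator L (sample_size M Y Ys \<epsilon> L) X)"
proof -
  define N where "N = sample_size M Y Ys \<epsilon> L"
  define w where "w = weak_error M Y Ys L"
  define v where "v = variance (\<lambda>\<omega>. Ys 1 \<omega> - Ys 0 \<omega>)"
  have L: "L \<ge> 1" using mlmc by (simp add: mlmc_setup_def)
  have w: "w > 0" using mlmc_setup_weak_error_pos[OF mlmc] by (simp add: w_def)
  have v: "v > 0"
    using mlmc_setup_increment_variance_pos[OF mlmc, of 1] L by (simp add: v_def)
  have "1 / 2 \<le> 1 / w\<^sup>2" "1 / 2 \<le> v / w\<^sup>2"
    using mild by (simp_all add: mild_rounding_def powi_minus_two w_def v_def)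
  note twice = this[THEN ceiling_le_twice]
  have N0: "real (N 0) \<le> 2 * (1 / w\<^sup>2)"
    using twice(1) by (simp add: N_def w_def sample_size_0)
  \<comment> \<open>On level 1 the factor \<open>real l powr (1 + \<epsilon>)\<close> equals 1, so
    \<open>\<epsilon>\<close> disappears from the sample size.\<close>
  have N1: "real (N 1) \<le> 2 * (v / w\<^sup>2)"
    using twice(2) by (simp add: N_def w_def v_def sample_size_pos_level)
  have pos: "real (N 0) > 0" "real (N 1) > 0"
    using mlmc_setup_sample_size_pos[OF mlmc, of 0] mlmc_setup_sample_size_pos[OF mlmc, of 1] L
    by (auto simp: N_def)
  have "variance (Ys 0) / (2 * (1 / w\<^sup>2)) \<le> variance (Ys 0) / real (N 0)"
    using pos w N0 by (intro divide_left_mono mult_pos_pos) auto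
  then have "variance (Ys 0) * w\<^sup>2 / 2 \<le> variance (Ys 0) / real (N 0)"
    by (simp add: mult.commute)
  moreover have "v / (2 * (v / w\<^sup>2)) \<le> v / real (N 1)"
    using pos v w N1 by (intro divide_left_mono mult_pos_pos) auto
  then have "w\<^sup>2 / 2 \<le> v / real (N 1)"
    using v by simp
  moreover have "(variance (Ys 0) + 1) / 2 * w\<^sup>2 = variance (Ys 0) * w\<^sup>2 / 2 + w\<^sup>2 / 2"
    by (simp add: field_simps)
  ultimately have "(variance (Ys 0) + 1) / 2 * w\<^sup>2 \<le> variance (Ys 0) / real (N 0) + v / real (N 1)"
    by linarith
  then show ?thesis
    using mlmc_variance_ge[OF mlmc, OF Ys] unfolding N_def w_def v_def by linarith
qed

section \<open>From variance bounds to bounds on the sampling error\<close>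

lemma sampling_error_norm_le:
  assumes mlmc: "mlmc_setup M Y Ys \<epsilon> L X"
    and Y: "square_integrable M Y" and Ys: "\<And>l. square_integrable M (Ys l)" and eps: "\<epsilon> > 0"
  shows "sampling_error_norm M Y Ys \<epsilon> L X
    \<le> sqrt (variance (Ys 0) + real_zeta (1 + \<epsilon>)) * weak_error M Y Ys L"
proof -
  have "sampling_error_norm M Y Ys \<epsilon> L X
      \<le> sqrt (variance (mlmc_estimator L (sample_size M Y Ys \<epsilon> L) X))"
    by (rule sampling_error_norm_bounds(2)[OF mlmc, OF Y Ys])
  also have "\<dots> \<le> sqrt ((variance (Ys 0) + real_zeta (1 + \<epsilon>)) * (weak_error M Y Ys L)\<^sup>2)"
    by (intro real_sqrt_le_mono mlmc_variance_le mlmc Ys eps)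
  also have "\<dots> = sqrt (variance (Ys 0) + real_zeta (1 + \<epsilon>)) * weak_error M Y Ys L"
    using mlmc_setup_weak_error_pos[OF mlmc] by (simp add: real_sqrt_mult)
  finally show ?thesis .
qed

text \<open>Common last step of both lower bounds: \<open>k\<close> is
  \<open>(variance (Ys 0) + 1) / 2\<close> under mild rounding and
  \<open>?v / (?v + B\<^sup>2)\<close> in the bound uniform in \<open>L\<close>.\<close>

lemma sampling_error_norm_ge:
  assumes mlmc: "mlmc_setup M Y Ys \<epsilon> L X"
    and Y: "square_integrable M Y" and Ys: "\<And>l. square_integrable M (Ys l)"
    and var: "k * (weak_error M Y Ys L)\<^sup>2
      \<le> variance (mlmc_estimator L (sample_size M Y Ys \<epsilon> L) X)"
  shows "(sqrt (1 + k) - 1) * weak_error M Y Ys L \<le> sampling_error_norm M Y Ys \<epsilon> L X"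
proof -
  define w where "w = weak_error M Y Ys L"
  have "sqrt (1 + k) * w = sqrt ((1 + k) * w\<^sup>2)"
    using mlmc_setup_weak_error_pos[OF mlmc] by (simp add: real_sqrt_mult w_def)
  also have "\<dots> \<le> sqrt (w\<^sup>2 + variance (mlmc_estimator L (sample_size M Y Ys \<epsilon> L) X))"
    using var by (intro real_sqrt_le_mono) (simp add: w_def distrib_right)
  finally show ?thesis
    using sampling_error_norm_bounds(3)[OF mlmc, OF Y Ys] by (simp add: w_def left_diff_distrib)
qed

text \<open>The constant is \<open>sqrt (1 + k) - 1\<close> with
  \<open>k = (variance (Ys 0) + 1) / 2\<close>, for which \<open>1 + k\<close> is
  \<open>(3 + variance (Ys 0)) / 2\<close>.\<close>

lemma sampling_error_norm_ge_mild_rounding: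
  assumes mlmc: "mlmc_setup M Y Ys \<epsilon> L X"
    and Y: "square_integrable M Y" and Ys: "\<And>l. square_integrable M (Ys l)"
    and mild: "mild_rounding M Y Ys L"
  shows "(2 powr (-1/2) * sqrt (3 + variance (Ys 0)) - 1) * weak_error M Y Ys L
    \<le> sampling_error_norm M Y Ys \<epsilon> L X"
proof -
  have "2 powr (-1/2) * sqrt (3 + variance (Ys 0)) = sqrt ((3 + variance (Ys 0)) / 2)"
    by (simp add: powr_minus_divide powr_half_sqrt real_sqrt_divide)
  also have "(3 + variance (Ys 0)) / 2 = 1 + (variance (Ys 0) + 1) / 2"
    by (simp add: field_simps)
  finally show ?thesis
    using sampling_error_norm_ge[OF mlmc, OF Y Ys mlmc_variance_ge_mild_rounding[OF mlmc, OF Ys mild]]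
    by simp
qed

section \<open>Lower bounds for large levels and uniformly in the level\<close>

text \<open>For a nonzero weak error, mild rounding says that its square is at most 2 and at most
  \<open>2 * v\<close>, which holds once it is small. A zero weak error must be excluded, since
  \<open>0 powi (-2)\<close> is 0.\<close>

lemma eventually_mild_rounding:
  assumes lim: "weak_error M Y Ys \<longlonglongrightarrow> 0" and v: "variance (\<lambda>\<omega>. Ys 1 \<omega> - Ys 0 \<omega>) > 0"
  shows "\<forall>\<^sub>F L in sequentially. weak_error M Y Ys L \<noteq> 0 \<longrightarrow> mild_rounding M Y Ys L"
proof -
  define v where "v = variance (\<lambda>\<omega>. Ys 1 \<omega> - Ys 0 \<omega>)"
  have "(\<lambda>L. (weak_error M Y Ys L)\<^sup>2) \<longlonglongrightarrow> 0"
    using tendsto_power[OF lim, of 2] by simp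
  then have "\<forall>\<^sub>F L in sequentially. (weak_error M Y Ys L)\<^sup>2 < min 2 (2 * v)"
    by (rule order_tendstoD(2)) (use v in \<open>simp add: v_def\<close>)
  then show ?thesis
  proof eventually_elim
    case (elim L)
    show ?case
    proof
      assume "weak_error M Y Ys L \<noteq> 0"
      then have "(weak_error M Y Ys L)\<^sup>2 > 0" by simp
      then show "mild_rounding M Y Ys L"
        using elim unfolding mild_rounding_def powi_minus_two v_def[symmetric]
        by (simp add: field_simps)
    qed
  qed
qed

text \<open>Only level 1 is used: rounding up adds at most 1 to its sample size, and the weak error
  is bounded, so this level alone keeps the variance above a multiple of the squared weak error,
  uniformly in \<open>L\<close>.\<close>

lemma mlmc_variance_ge_uniform:
  assumes mlmc: "mlmc_setup M Y Ys \<epsilon> L X" and Ys: "\<And>l. square_integrable M (Ys l)"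
    and B: "weak_error M Y Ys L \<le> B"
  defines "v \<equiv> variance (\<lambda>\<omega>. Ys 1 \<omega> - Ys 0 \<omega>)"
  shows "v / (v + B\<^sup>2) * (weak_error M Y Ys L)\<^sup>2
    \<le> variance (mlmc_estimator L (sample_size M Y Ys \<epsilon> L) X)"
proof -
  define N where "N = sample_size M Y Ys \<epsilon> L"
  define w where "w = weak_error M Y Ys L"
  have L: "L \<ge> 1" using mlmc by (simp add: mlmc_setup_def)
  have w: "w > 0" using mlmc_setup_weak_error_pos[OF mlmc] by (simp add: w_def)
  have v: "v > 0"
    using mlmc_setup_increment_variance_pos[OF mlmc, of 1] L by (simp add: v_def)
  have N1: "real (N 1) > 0"
    using mlmc_setup_sample_size_pos[OF mlmc L] by (simp add: N_def)
  have wB: "w\<^sup>2 \<le> B\<^sup>2" using w B by (intro power_mono) (auto simp: w_def)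
  have "N 1 = nat \<lceil>v / w\<^sup>2\<rceil>"
    by (simp add: N_def w_def v_def sample_size_pos_level)
  then have "real (N 1) \<le> v / w\<^sup>2 + 1"
    using N1 by linarith
  \<comment> \<open>Replacing \<open>w\<^sup>2\<close> by \<open>B\<^sup>2\<close> in the numerator
    makes the constant \<open>v / (v + B\<^sup>2)\<close> independent of \<open>L\<close>.\<close>
  also have "\<dots> = (v + w\<^sup>2) / w\<^sup>2" using w by (simp add: field_simps)
  also have "\<dots> \<le> (v + B\<^sup>2) / w\<^sup>2" using wB by (intro divide_right_mono) auto
  finally have le: "real (N 1) \<le> (v + B\<^sup>2) / w\<^sup>2" .
  have "v / ((v + B\<^sup>2) / w\<^sup>2) \<le> v / real (N 1)"
    using le N1 v by (intro divide_left_mono mult_pos_pos) linarith+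
  moreover have "v / (v + B\<^sup>2) * w\<^sup>2 = v / ((v + B\<^sup>2) / w\<^sup>2)"
    by simp
  moreover have "0 \<le> variance (Ys 0) / real (N 0)"
    by (intro divide_nonneg_nonneg variance_positive) auto
  ultimately show ?thesis
    using mlmc_variance_ge[OF mlmc, OF Ys] unfolding N_def w_def v_def by linarith
qed

end

text \<open>The equivalence is stated with \<open>c\<close> and \<open>C\<close> chosen before
  \<open>L\<close> and \<open>X\<close>. Its \<open>c\<close> may be smaller than the explicit
  constant, because on the finitely many levels before mild rounding sets in the explicit bound can
  fail.\<close>

theorem corollary2p5:
  fixes M :: "'a measure" and Y :: "'a \<Rightarrow> real" and Ys :: "nat \<Rightarrow> 'a \<Rightarrow> real" and \<epsilon> :: real
  assumes "prob_space M"
    and "square_integrable M Y"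
    and "\<And>l. square_integrable M (Ys l)"
    and "(\<lambda>l. \<bar>prob_space.expectation M (\<lambda>\<omega>. Y \<omega> - Ys l \<omega>)\<bar>) \<longlonglongrightarrow> 0"
    and "\<epsilon> > 0"
  shows
    "(\<forall>L X. mlmc_setup M Y Ys \<epsilon> L X \<longrightarrow>
        square_integrable M (sampling_error M Y Ys L (sample_size M Y Ys \<epsilon> L) X) \<and>
        sampling_error_norm M Y Ys \<epsilon> L X
          \<le> sqrt (prob_space.variance M (Ys 0) + real_zeta (1 + \<epsilon>)) * weak_error M Y Ys L \<and>
        (mild_rounding M Y Ys L \<longrightarrow>
          sampling_error_norm M Y Ys \<epsilon> L X
            \<ge> (2 powr (-1/2) * sqrt (3 + prob_space.variance M (Ys 0)) - 1) * weak_error M Y Ys L)) \<and>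
     (\<forall>\<^sub>F L in sequentially. \<forall>X. mlmc_setup M Y Ys \<epsilon> L X \<longrightarrow>
        sampling_error_norm M Y Ys \<epsilon> L X
          \<ge> (2 powr (-1/2) * sqrt (3 + prob_space.variance M (Ys 0)) - 1) * weak_error M Y Ys L) \<and>
     (\<exists>c>0. \<exists>C>0. \<forall>L X. mlmc_setup M Y Ys \<epsilon> L X \<longrightarrow>
        c * weak_error M Y Ys L \<le> sampling_error_norm M Y Ys \<epsilon> L X \<and>
        sampling_error_norm M Y Ys \<epsilon> L X \<le> C * weak_error M Y Ys L)"
proof -
  interpret prob_space M by fact
  note Y = assms(2) and Ys = assms(3) and eps = assms(5)
  let ?w = "weak_error M Y Ys"
  let ?v = "variance (\<lambda>\<omega>. Ys 1 \<omega> - Ys 0 \<omega>)"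
  let ?C = "sqrt (variance (Ys 0) + real_zeta (1 + \<epsilon>))"
  let ?c = "2 powr (-1/2) * sqrt (3 + variance (Ys 0)) - 1"
  have lim: "?w \<longlonglongrightarrow> 0"
    using assms(4) by (simp add: weak_error_def[abs_def])
  have v_pos: "?v > 0" if "mlmc_setup M Y Ys \<epsilon> L X" for L X
    using mlmc_setup_increment_variance_pos[OF that, of 1] that by (simp add: mlmc_setup_def)
  have eventually_ge: "\<forall>\<^sub>F L in sequentially. \<forall>X. mlmc_setup M Y Ys \<epsilon> L X \<longrightarrow>
      sampling_error_norm M Y Ys \<epsilon> L X \<ge> ?c * ?w L"
  \<comment> \<open>If \<open>?v\<close> is not positive, no level admits a setup and the claim is
    vacuous.\<close>
  proof (cases "?v > 0")
    case True
    show ?thesis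
      using eventually_mild_rounding[OF lim True]
    proof eventually_elim
      case (elim L)
      then show ?case
        using sampling_error_norm_ge_mild_rounding[of Y Ys, OF _ Y Ys] by (auto simp: mlmc_setup_def)
    qed
  next
    case False
    then show ?thesis using v_pos by (intro always_eventually) blast
  qed
  \<comment> \<open>A convergent sequence is bounded; this one \<open>B\<close> serves all levels in
    \<open>mlmc_variance_ge_uniform\<close>.\<close>
  obtain B where B: "?w L \<le> B" for L
    using convergent_imp_Bseq[OF convergentI[OF lim]]
    by (auto simp: Bseq_def dest: abs_le_D1)
  \<comment> \<open>The first term of the series is 1, which keeps \<open>?C\<close> positive even
    when \<open>Ys 0\<close> has variance 0.\<close>
  have "1 \<le> real_zeta (1 + \<epsilon>)"
    using sum_le_real_zeta[of "1 + \<epsilon>" 1] eps by simp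
  then have C: "?C > 0"
    using variance_positive[of "Ys 0"] by (simp add: add_nonneg_pos)
  have "\<exists>c>0. \<forall>L X. mlmc_setup M Y Ys \<epsilon> L X \<longrightarrow> c * ?w L \<le> sampling_error_norm M Y Ys \<epsilon> L X"
  proof (cases "?v > 0")
    case True
    have "?v / (?v + B\<^sup>2) > 0" using True by (simp add: add_pos_nonneg)
    then have "sqrt (1 + ?v / (?v + B\<^sup>2)) - 1 > 0" by simp
    then show ?thesis
      using sampling_error_norm_ge[of Y Ys, OF _ Y Ys mlmc_variance_ge_uniform[of Y Ys, OF _ Ys B]] by blast
  next
    case False
    \<comment> \<open>Again there is no setup, so any positive witness will do.\<close>
    then show ?thesis using v_pos by (intro exI[of _ 1]) auto
  qed
  then have equivalence: "\<exists>c>0. \<exists>C>0. \<forall>L X. mlmc_setup M Y Ys \<epsilon> L X \<longrightarrow>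
      c * ?w L \<le> sampling_error_norm M Y Ys \<epsilon> L X \<and> sampling_error_norm M Y Ys \<epsilon> L X \<le> C * ?w L"
    using C sampling_error_norm_le[of Y Ys, OF _ Y Ys eps] by blast
  show ?thesis
    using sampling_error_norm_bounds(1)[of Y Ys, OF _ Y Ys] sampling_error_norm_le[of Y Ys, OF _ Y Ys eps]
      sampling_error_norm_ge_mild_rounding[of Y Ys, OF _ Y Ys] eventually_ge equivalence
    by (intro conjI) blast+
qed

end
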